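(* Let $Z_1,Z_2$ be real-valued, absolutely continuous random variables (defined on a common probability space) with distribution functions $G_1$ and $G_2$. For $(t,s)\in\mathbb{R}^2$ set $$f_{Z_1,Z_2}(t,s):=\mathbb{E}\exp\big(itG_1(Z_1)+isG_2(Z_2)\big)-\mathbb{E}\exp\big(itG_1(Z_1)\big)\,\mathbb{E}\exp\big(isG_2(Z_2)\big),$$ and let $f_{Z_1,Z_1}$ and $f_{Z_2,Z_2}$ be defined in the same way with the pair $(Z_1,Z_2)$ replaced by $(Z_1,Z_1)$, resp. $(Z_2,Z_2)$ (and $(G_1,G_2)$ by $(G_1,G_1)$, resp. $(G_2,G_2)$). Then, for any finite $c>0$, $$\lim_{t,s\to0,\ |t|/|s|\to c}\ \frac{|f_{Z_1,Z_2}(t,s)|^2}{|f_{Z_1,Z_1}(t,s)|\,|f_{Z_2,Z_2}(t,s)|}=\rho^2\big(G_1(Z_1),G_2(Z_2)\big),$$ where $\rho^2(G_1(Z_1),G_2(Z_2))$ denotes the square of the usual (Pearson) correlation between $G_1(Z_1)$ and $G_2(Z_2)$.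
   Context: Here $i=\sqrt{-1}$. The limit is along $t,s\to0$ (with $t,s\neq 0$) such that $|t|/|s|\to c$. *)

theory Defs
  imports "HOL-Probability.Probability"
begin

definition rv_cdf :: "'a measure \<Rightarrow> ('a \<Rightarrow> real) \<Rightarrow> real \<Rightarrow> real" where
  "rv_cdf M Z = cdf (distr M borel Z)"

definition abs_continuous_rv :: "'a measure \<Rightarrow> ('a \<Rightarrow> real) \<Rightarrow> bool" where
  "abs_continuous_rv M Z \<longleftrightarrow>
     Z \<in> borel_measurable M \<and> absolutely_continuous lborel (distr M borel Z)"

definition cf_diff :: "'a measure \<Rightarrow> ('a \<Rightarrow> real) \<Rightarrow> ('a \<Rightarrow> real) \<Rightarrow> real \<Rightarrow> real \<Rightarrow> complex" where
  "cf_diff M X Y t s =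
     (\<integral>\<omega>. exp (\<i> * of_real t * of_real (rv_cdf M X (X \<omega>)) + \<i> * of_real s * of_real (rv_cdf M Y (Y \<omega>))) \<partial>M)
     - (\<integral>\<omega>. exp (\<i> * of_real t * of_real (rv_cdf M X (X \<omega>))) \<partial>M)
       * (\<integral>\<omega>. exp (\<i> * of_real s * of_real (rv_cdf M Y (Y \<omega>))) \<partial>M)"

definition covariance :: "'a measure \<Rightarrow> ('a \<Rightarrow> real) \<Rightarrow> ('a \<Rightarrow> real) \<Rightarrow> real" where
  "covariance M X Y =
     (\<integral>\<omega>. (X \<omega> - (\<integral>\<omega>'. X \<omega>' \<partial>M)) * (Y \<omega> - (\<integral>\<omega>'. Y \<omega>' \<partial>M)) \<partial>M)"

definition correlation :: "'a measure \<Rightarrow> ('a \<Rightarrow> real) \<Rightarrow> ('a \<Rightarrow> real) \<Rightarrow> real" where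
  "correlation M X Y =
     covariance M X Y / (sqrt (prob_space.variance M X) * sqrt (prob_space.variance M Y))"

text \<open>The filter of pairs \<open>(t, s)\<close> of nonzero reals with \<open>t, s \<rightarrow> 0\<close> and \<open>\<bar>t\<bar> / \<bar>s\<bar> \<rightarrow> c\<close>.\<close>

definition ratio_filter :: "real \<Rightarrow> (real \<times> real) filter" where
  "ratio_filter c =
     inf (at 0 \<times>\<^sub>F at 0) (filtercomap (\<lambda>(t, s). \<bar>t\<bar> / \<bar>s\<bar>) (nhds c))"

text \<open>The filter is proper, so limits along it are unique.\<close>

lemma ratio_filter_neq_bot:
  assumes "c > 0"
  shows "ratio_filter c \<noteq> bot"
proof -
  let ?u = "\<lambda>n. (c * inverse (real (Suc n)), inverse (real (Suc n)))"
  have s: "((\<lambda>n. inverse (real (Suc n))) \<longlongrightarrow> 0) sequentially"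
    by (rule LIMSEQ_inverse_real_of_nat)
  have t: "((\<lambda>n. c * inverse (real (Suc n))) \<longlongrightarrow> 0) sequentially"
    using tendsto_mult_left[OF s, of c] by simp
  have 1: "filterlim ?u (at 0 \<times>\<^sub>F at 0) sequentially"
    using s t assms by (intro filterlim_Pair filterlim_atI always_eventually) auto
  have "(\<lambda>n. case ?u n of (t, s) \<Rightarrow> \<bar>t\<bar> / \<bar>s\<bar>) = (\<lambda>n. c)"
    using assms by (auto simp: abs_mult)
  then have "filterlim ?u (filtercomap (\<lambda>(t, s). \<bar>t\<bar> / \<bar>s\<bar>) (nhds c)) sequentially"
    by (simp add: filterlim_filtercomap_iff o_def)
  with 1 have "filterlim ?u (ratio_filter c) sequentially"
    unfolding ratio_filter_def by (simp add: filterlim_inf)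
  then show ?thesis
    by (metis bot.extremum_uniqueI filterlim_def filtermap_bot_iff sequentially_bot)
qed

end

theory Submission
  imports Defs
begin

text \<open>Write \<open>U = G\<^sub>1(Z\<^sub>1)\<close> and \<open>V = G\<^sub>2(Z\<^sub>2)\<close>. Covariances ignore constants, so
  \<open>f(t,s)/(ts)\<close> is the covariance of \<open>(e\<^sup>i\<^sup>t\<^sup>U - 1)/t\<close> and \<open>(e\<^sup>i\<^sup>s\<^sup>V - 1)/s\<close>, which converge
  uniformly to \<open>iU\<close> and \<open>iV\<close> because \<open>U\<close> and \<open>V\<close> are bounded. Hence \<open>f(t,s)/(ts)\<close> tends
  to \<open>-Cov(U,V)\<close>, and the factors \<open>ts\<close> cancel in the quotient.
  The limits of the denominators do not vanish: \<open>G\<^sub>1\<close> and \<open>G\<^sub>2\<close> are continuous, so \<open>U\<close> and \<open>V\<close>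
  are not almost surely constant.\<close>

section \<open>Uniform limits under the expectation and under difference quotients\<close>

text \<open>The total mass is 1, so a uniform bound on the difference of the integrands also bounds
  the difference of the expectations. Uniform convergence makes this work along an arbitrary filter
  \<open>F\<close>, without passing to sequences.\<close>

lemma (in prob_space) uniform_limit_expectation:
  fixes g :: "'b \<Rightarrow> 'a \<Rightarrow> 'c::{banach, second_countable_topology}"
  assumes lim: "uniform_limit (space M) g h F"
    and g: "\<And>p. integrable M (g p)" and h: "integrable M h"
  shows "((\<lambda>p. expectation (g p)) \<longlongrightarrow> expectation h) F"
proof (rule tendstoI)
  fix e :: real assume "e > 0"
  \<comment> \<open>Integration only keeps a non-strict bound; halving \<open>e\<close> restores the
    strict one.\<close>
  then have "\<forall>\<^sub>F p in F. \<forall>x\<in>space M. dist (g p x) (h x) < e / 2"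
    using lim by (intro uniform_limitD) auto
  then show "\<forall>\<^sub>F p in F. dist (expectation (g p)) (expectation h) < e"
  proof eventually_elim
    case (elim p)
    have "dist (expectation (g p)) (expectation h) = norm (expectation (\<lambda>x. g p x - h x))"
      using g h by (simp add: dist_norm)
    also have "\<dots> \<le> expectation (\<lambda>x. norm (g p x - h x))"
      by (rule integral_norm_bound)
    also have "\<dots> \<le> e / 2"
      using g h elim by (intro integral_le_const) (auto simp: dist_norm intro!: AE_I2 less_imp_le)
    also have "\<dots> < e"
      using \<open>e > 0\<close> by simp
    finally show ?case .
  qed
qed

text \<open>This is the first-order Taylor remainder of the exponential at \<open>t * x\<close>,
  divided by \<open>t\<close>.\<close>

lemma norm_iexp_quotient_le:
  assumes "t \<noteq> 0"
  shows "cmod ((iexp (t * x) - 1) / of_real t - \<i> * of_real x) \<le> \<bar>t\<bar> * x\<^sup>2 / 2"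
proof -
  have "(iexp (t * x) - 1) / of_real t - \<i> * of_real x
        = (iexp (t * x) - (1 + \<i> * of_real (t * x))) / of_real t"
    using assms by (simp add: field_simps)
  then have "cmod ((iexp (t * x) - 1) / of_real t - \<i> * of_real x)
        = cmod (iexp (t * x) - (1 + \<i> * of_real (t * x))) / \<bar>t\<bar>"
    by (simp add: norm_divide)
  also have "\<dots> \<le> (\<bar>t * x\<bar>\<^sup>2 / 2) / \<bar>t\<bar>"
    using iexp_approx1[of "t * x" 1]
    by (intro divide_right_mono) (auto simp: numeral_2_eq_2)
  also have "\<dots> = \<bar>t\<bar> * x\<^sup>2 / 2"
    using assms by (simp add: power2_eq_square abs_mult)
  finally show ?thesis .
qed

text \<open>For a bounded \<open>X\<close> the Taylor error is at most
  \<open>\<bar>t\<bar> * B\<^sup>2 / 2\<close>, which does not depend on the point.\<close>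

lemma uniform_limit_iexp_quotient:
  fixes X :: "'a \<Rightarrow> real"
  assumes B: "\<And>x. x \<in> A \<Longrightarrow> \<bar>X x\<bar> \<le> B"
  shows "uniform_limit A (\<lambda>t x. (iexp (t * X x) - 1) / of_real t) (\<lambda>x. \<i> * of_real (X x)) (at 0)"
proof (rule uniform_limitI)
  fix e :: real assume "e > 0"
  have "((\<lambda>t. \<bar>t\<bar> * B\<^sup>2 / 2) \<longlongrightarrow> \<bar>0\<bar> * B\<^sup>2 / 2) (at 0)"
    by (intro tendsto_intros) auto
  then have "\<forall>\<^sub>F t in at 0. \<bar>t\<bar> * B\<^sup>2 / 2 < e"
    using \<open>e > 0\<close> by (intro order_tendstoD(2)) auto
  moreover have "\<forall>\<^sub>F t in at 0. t \<noteq> (0::real)"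
    by (simp add: eventually_at_filter)
  ultimately show "\<forall>\<^sub>F t in at 0. \<forall>x\<in>A.
      dist ((iexp (t * X x) - 1) / of_real t) (\<i> * of_real (X x)) < e"
  proof eventually_elim
    case (elim t)
    show ?case
    proof
      fix x assume "x \<in> A"
      then have "(X x)\<^sup>2 \<le> B\<^sup>2"
        using B by (metis abs_ge_zero power2_abs power_mono)
      then have "\<bar>t\<bar> * (X x)\<^sup>2 / 2 \<le> \<bar>t\<bar> * B\<^sup>2 / 2"
        by (intro divide_right_mono mult_left_mono) auto
      then show "dist ((iexp (t * X x) - 1) / of_real t) (\<i> * of_real (X x)) < e"
        using norm_iexp_quotient_le[of t "X x"] elim unfolding dist_norm by linarith
    qed
  qed
qed

lemma eventually_prod_at_0_neq:
  "\<forall>\<^sub>F p in at (0::real) \<times>\<^sub>F at (0::real). fst p \<noteq> 0 \<and> snd p \<noteq> 0"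
  unfolding eventually_prod_filter
  by (rule exI[of _ "\<lambda>t. t \<noteq> 0"], rule exI[of _ "\<lambda>t. t \<noteq> 0"])
    (auto simp: eventually_at_filter)

section \<open>Covariances of bounded variables and of their exponentials\<close>

lemma (in prob_space) integrable_bounded_rv:
  fixes X :: "'a \<Rightarrow> 'b::{banach, second_countable_topology}"
  assumes "random_variable borel X" "\<And>\<omega>. \<omega> \<in> space M \<Longrightarrow> norm (X \<omega>) \<le> B"
  shows "integrable M X"
  using assms by (intro integrable_const_bound[where B = B]) auto

lemma (in prob_space) covariance_eq:
  assumes X: "integrable M X" and Y: "integrable M Y" and XY: "integrable M (\<lambda>\<omega>. X \<omega> * Y \<omega>)"
  shows "covariance M X Y = expectation (\<lambda>\<omega>. X \<omega> * Y \<omega>) - expectation X * expectation Y"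
proof -
  have "covariance M X Y = expectation (\<lambda>\<omega>. X \<omega> * Y \<omega> - expectation Y * X \<omega>
      - expectation X * Y \<omega> + expectation X * expectation Y)"
    unfolding covariance_def by (intro Bochner_Integration.integral_cong) (auto simp: algebra_simps)
  also have "\<dots> = expectation (\<lambda>\<omega>. X \<omega> * Y \<omega>) - expectation X * expectation Y"
    using X Y XY by (simp add: prob_space)
  finally show ?thesis .
qed

text \<open>Subtracting 1 from each exponential does not change the numerator and turns the
  expression into a covariance of difference quotients. The minus sign in the limit is
  \<open>\<i> * \<i>\<close>.\<close>

lemma (in prob_space) iexp_covariance_quotient_tendsto:
  fixes X Y :: "'a \<Rightarrow> real"
  assumes X[measurable]: "random_variable borel X" and Y[measurable]: "random_variable borel Y"
    and BX: "\<And>\<omega>. \<omega> \<in> space M \<Longrightarrow> \<bar>X \<omega>\<bar> \<le> B" and BY: "\<And>\<omega>. \<omega> \<in> space M \<Longrightarrow> \<bar>Y \<omega>\<bar> \<le> B"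
  shows "((\<lambda>(t, s). (expectation (\<lambda>\<omega>. iexp (t * X \<omega>) * iexp (s * Y \<omega>))
            - expectation (\<lambda>\<omega>. iexp (t * X \<omega>)) * expectation (\<lambda>\<omega>. iexp (s * Y \<omega>)))
            / of_real (t * s))
          \<longlongrightarrow> - of_real (covariance M X Y)) (at 0 \<times>\<^sub>F at 0)"
proof -
  let ?F = "at (0::real) \<times>\<^sub>F at (0::real)"
  define a where "a t \<omega> = (iexp (t * X \<omega>) - 1) / of_real t" for t \<omega>
  define b where "b s \<omega> = (iexp (s * Y \<omega>) - 1) / of_real s" for s \<omega>
  have [measurable]: "a t \<in> borel_measurable M" "b t \<in> borel_measurable M" for t
    unfolding a_def b_def by measurable
  have iX: "integrable M (\<lambda>\<omega>. iexp (t * X \<omega>))" for t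
    by (rule integrable_bounded_rv[where B = 1]) auto
  have iY: "integrable M (\<lambda>\<omega>. iexp (s * Y \<omega>))" for s
    by (rule integrable_bounded_rv[where B = 1]) auto
  have iXY: "integrable M (\<lambda>\<omega>. iexp (t * X \<omega>) * iexp (s * Y \<omega>))" for t s
    by (rule integrable_bounded_rv[where B = 1]) (auto simp: norm_mult)
  \<comment> \<open>At parameter 0 the quotients are 0, because division by zero yields 0; so this
    and the identity \<open>ab\<close> hold for all parameters.\<close>
  have ia: "integrable M (a t)" and ib: "integrable M (b t)" for t
    unfolding a_def b_def using iX iY by auto
  have ab: "a t \<omega> * b s \<omega> = (iexp (t * X \<omega>) * iexp (s * Y \<omega>) - iexp (t * X \<omega>)
      - iexp (s * Y \<omega>) + 1) / of_real (t * s)" for t s \<omega>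
    by (simp add: a_def b_def field_simps)
  have iab: "integrable M (\<lambda>\<omega>. a t \<omega> * b s \<omega>)" for t s
    unfolding ab using iX iY iXY by auto
  have intX: "integrable M X" and intY: "integrable M Y"
    using BX BY by (auto intro!: integrable_bounded_rv[where B = B])
  have intXY: "integrable M (\<lambda>\<omega>. X \<omega> * Y \<omega>)"
    using BX BY by (intro integrable_bounded_rv[where B = "B * B"])
      (auto simp: abs_mult intro!: mult_mono order_trans[OF abs_ge_zero])
  have la: "uniform_limit (space M) (\<lambda>p. a (fst p)) (\<lambda>\<omega>. \<i> * of_real (X \<omega>)) ?F"
    unfolding a_def
    by (rule filterlim_compose[OF uniform_limit_iexp_quotient[OF BX] filterlim_fst])
  have lb: "uniform_limit (space M) (\<lambda>p. b (snd p)) (\<lambda>\<omega>. \<i> * of_real (Y \<omega>)) ?F"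
    unfolding b_def
    by (rule filterlim_compose[OF uniform_limit_iexp_quotient[OF BY] filterlim_snd])
  \<comment> \<open>A product of uniform limits is uniform here because both limit functions are
    bounded.\<close>
  have lab: "uniform_limit (space M) (\<lambda>p \<omega>. a (fst p) \<omega> * b (snd p) \<omega>)
      (\<lambda>\<omega>. (\<i> * of_real (X \<omega>)) * (\<i> * of_real (Y \<omega>))) ?F"
    using BX BY by (intro uniform_lim_mult la lb) (auto intro!: boundedI[where B = B] simp: norm_mult)
  have "((\<lambda>p. expectation (\<lambda>\<omega>. a (fst p) \<omega> * b (snd p) \<omega>)
        - expectation (a (fst p)) * expectation (b (snd p)))
      \<longlongrightarrow> expectation (\<lambda>\<omega>. (\<i> * of_real (X \<omega>)) * (\<i> * of_real (Y \<omega>)))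
        - expectation (\<lambda>\<omega>. \<i> * of_real (X \<omega>)) * expectation (\<lambda>\<omega>. \<i> * of_real (Y \<omega>))) ?F"
    using intX intY intXY iab ia ib
    by (intro tendsto_intros uniform_limit_expectation la lb lab)
      (auto simp: mult_ac simp flip: of_real_mult)
  also have "expectation (\<lambda>\<omega>. (\<i> * of_real (X \<omega>)) * (\<i> * of_real (Y \<omega>)))
        - expectation (\<lambda>\<omega>. \<i> * of_real (X \<omega>)) * expectation (\<lambda>\<omega>. \<i> * of_real (Y \<omega>))
      = - of_real (covariance M X Y)"
  proof -
    have "expectation (\<lambda>\<omega>. (\<i> * of_real (X \<omega>)) * (\<i> * of_real (Y \<omega>)))
        = expectation (\<lambda>\<omega>. - complex_of_real (X \<omega> * Y \<omega>))"
      by (intro Bochner_Integration.integral_cong) (auto simp: algebra_simps)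
    also have "\<dots> = - of_real (expectation (\<lambda>\<omega>. X \<omega> * Y \<omega>))"
      by (simp only: Bochner_Integration.integral_minus integral_complex_of_real)
    finally show ?thesis
      unfolding covariance_eq[OF intX intY intXY] by (simp add: algebra_simps)
  qed
  finally show ?thesis
  proof (rule Lim_transform_eventually)
    show "\<forall>\<^sub>F p in ?F. expectation (\<lambda>\<omega>. a (fst p) \<omega> * b (snd p) \<omega>)
        - expectation (a (fst p)) * expectation (b (snd p)) =
        (case p of (t, s) \<Rightarrow> (expectation (\<lambda>\<omega>. iexp (t * X \<omega>) * iexp (s * Y \<omega>))
            - expectation (\<lambda>\<omega>. iexp (t * X \<omega>)) * expectation (\<lambda>\<omega>. iexp (s * Y \<omega>)))
            / of_real (t * s))"
      using eventually_prod_at_0_neq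
    proof eventually_elim
      case (elim p)
      obtain t s where p: "p = (t, s)" by (cases p)
      define Exy where "Exy = expectation (\<lambda>\<omega>. iexp (t * X \<omega>) * iexp (s * Y \<omega>))"
      define Ex where "Ex = expectation (\<lambda>\<omega>. iexp (t * X \<omega>))"
      define Ey where "Ey = expectation (\<lambda>\<omega>. iexp (s * Y \<omega>))"
      have 1: "expectation (\<lambda>\<omega>. a t \<omega> * b s \<omega>) = (Exy - Ex - Ey + 1) / of_real (t * s)"
        unfolding ab Exy_def Ex_def Ey_def using iX iY iXY
        by (simp add: prob_space del: of_real_mult)
      have 2: "expectation (a t) = (Ex - 1) / of_real t"
        unfolding a_def Ex_def using iX by (simp add: prob_space del: of_real_mult)
      have 3: "expectation (b s) = (Ey - 1) / of_real s"
        unfolding b_def Ey_def using iY by (simp add: prob_space del: of_real_mult)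
      \<comment> \<open>The constants cancel:
        \<open>(Exy - Ex - Ey + 1) - (Ex - 1) * (Ey - 1) = Exy - Ex * Ey\<close>.\<close>
      show ?case
        using elim unfolding p fst_conv snd_conv prod.case Exy_def[symmetric] Ex_def[symmetric]
          Ey_def[symmetric] 1 2 3 by (simp add: field_simps)
    qed
  qed
qed

section \<open>The transformed variable \<open>G(Z)\<close>\<close>

text \<open>A distribution function is monotone, hence Borel, and takes values between 0 and
  1.\<close>

lemma (in prob_space) rv_cdf_transform:
  assumes [measurable]: "random_variable borel Z"
  shows "random_variable borel (\<lambda>\<omega>. rv_cdf M Z (Z \<omega>))" "\<bar>rv_cdf M Z x\<bar> \<le> 1"
proof -
  interpret D: real_distribution "distr M borel Z"
    by simp
  have [measurable]: "rv_cdf M Z \<in> borel_measurable borel"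
    unfolding rv_cdf_def by (intro borel_measurable_mono monoI D.cdf_nondecreasing)
  show "random_variable borel (\<lambda>\<omega>. rv_cdf M Z (Z \<omega>))"
    by measurable
  show "\<bar>rv_cdf M Z x\<bar> \<le> 1"
    unfolding rv_cdf_def using D.cdf_nonneg[of x] D.cdf_bounded_prob[of x] by simp
qed

lemma (in prob_space) cf_diff_quotient_tendsto:
  assumes "random_variable borel X" "random_variable borel Y"
  shows "((\<lambda>(t, s). cf_diff M X Y t s / of_real (t * s))
     \<longlongrightarrow> - of_real (covariance M (\<lambda>\<omega>. rv_cdf M X (X \<omega>)) (\<lambda>\<omega>. rv_cdf M Y (Y \<omega>))))
     (at 0 \<times>\<^sub>F at 0)"
  using iexp_covariance_quotient_tendsto[OF rv_cdf_transform(1)[OF assms(1)]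
      rv_cdf_transform(1)[OF assms(2)] rv_cdf_transform(2)[OF assms(1)] rv_cdf_transform(2)[OF assms(2)]]
  by (simp add: cf_diff_def exp_add mult.assoc)

text \<open>By the intermediate value theorem \<open>G\<close> takes the values \<open>1/3\<close> and \<open>2/3\<close>, so each of the
  events \<open>G(Z) \<le> 1/3\<close> and \<open>G(Z) \<ge> 2/3\<close> has positive probability.\<close>

lemma (in prob_space) variance_rv_cdf_pos:
  assumes "abs_continuous_rv M Z"
  shows "variance (\<lambda>\<omega>. rv_cdf M Z (Z \<omega>)) > 0"
proof -
  have Z[measurable]: "random_variable borel Z"
    and ac: "absolutely_continuous lborel (distr M borel Z)"
    using assms by (auto simp: abs_continuous_rv_def)
  interpret D: real_distribution "distr M borel Z"
    by simp
  define G where "G = rv_cdf M Z"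
  have G: "G x = prob {\<omega> \<in> space M. Z \<omega> \<le> x}" for x
    unfolding G_def rv_cdf_def cdf_def
    by (subst measure_distr) (auto intro!: arg_cong[where f = prob])
  have mono: "G x \<le> G y" if "x \<le> y" for x y
    unfolding G_def rv_cdf_def using that by (rule D.cdf_nondecreasing)
  have cont: "isCont G x" for x
  proof -
    \<comment> \<open>Points are Lebesgue null, so the law of \<open>Z\<close> has no atoms, which
      is continuity of its distribution function.\<close>
    have "{x} \<in> null_sets lborel"
      by (simp add: null_sets_def)
    then have "{x} \<in> null_sets (distr M borel Z)"
      using ac by (auto simp: absolutely_continuous_def)
    then show ?thesis
      unfolding G_def rv_cdf_def D.isCont_cdf by (simp add: null_sets_def measure_def)
  qed
  have attained: "\<exists>x. G x = y" if y: "0 < y" "y < 1" for y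
  proof -
    \<comment> \<open>The limits 0 and 1 of \<open>G\<close> at the two infinities provide the
      endpoints for the intermediate value theorem.\<close>
    obtain l where l: "G l < y"
      using order_tendstoD(2)[OF D.cdf_lim_at_bot y(1)]
      unfolding G_def rv_cdf_def by (auto simp: eventually_at_bot_linorder)
    obtain u where u: "G u > y"
      using order_tendstoD(1)[OF D.cdf_lim_at_top_prob y(2)]
      unfolding G_def rv_cdf_def by (auto simp: eventually_at_top_linorder)
    have "l \<le> u"
      using l u mono[of u l] by linarith
    then show ?thesis
      using IVT[of G l y u] l u cont by auto
  qed
  obtain a where a: "G a = 1/3" using attained[of "1/3"] by auto
  obtain b where b: "G b = 2/3" using attained[of "2/3"] by auto
  let ?U = "\<lambda>\<omega>. G (Z \<omega>)"
  have U[measurable]: "random_variable borel ?U" and U1: "\<bar>G x\<bar> \<le> 1" for x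
    using rv_cdf_transform[OF Z] by (auto simp: G_def)
  have "variance ?U \<noteq> 0"
  proof
    assume "variance ?U = 0"
    moreover have "integrable M (\<lambda>\<omega>. (?U \<omega> - expectation ?U)\<^sup>2)"
    proof (rule integrable_bounded_rv[where B = "(1 + \<bar>expectation ?U\<bar>)\<^sup>2"])
      fix \<omega>
      have "\<bar>?U \<omega> - expectation ?U\<bar> \<le> 1 + \<bar>expectation ?U\<bar>"
        using U1[of "Z \<omega>"] by linarith
      then have "\<bar>?U \<omega> - expectation ?U\<bar>\<^sup>2 \<le> (1 + \<bar>expectation ?U\<bar>)\<^sup>2"
        by (rule power_mono) simp
      then show "norm ((?U \<omega> - expectation ?U)\<^sup>2) \<le> (1 + \<bar>expectation ?U\<bar>)\<^sup>2"
        by simp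
    qed measurable
    ultimately have ae: "AE \<omega> in M. ?U \<omega> = expectation ?U"
      by (subst (asm) integral_nonneg_eq_0_iff_AE) auto
    \<comment> \<open>An event of positive probability cannot lie in the null set where
      \<open>G(Z)\<close> differs from its mean. Two such events then force the mean to be both
      \<le> 1/3 and \<ge> 2/3.\<close>
    have meets: "\<exists>\<omega>. P \<omega> \<and> ?U \<omega> = expectation ?U" if "prob {\<omega> \<in> space M. P \<omega>} > 0" for P
    proof (rule ccontr)
      assume "\<not> ?thesis"
      then have "AE \<omega> in M. \<not> P \<omega>"
        using ae by (auto elim: eventually_mono)
      then have "prob {\<omega> \<in> space M. P \<omega>} = 0"
        by (rule prob_eq_0_AE)
      then show False using that by simp
    qed
    obtain \<omega> where "Z \<omega> \<le> a" "?U \<omega> = expectation ?U"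
      using meets[of "\<lambda>\<omega>. Z \<omega> \<le> a"] a by (auto simp: G)
    then have "expectation ?U \<le> 1/3"
      using mono[of "Z \<omega>" a] a by simp
    moreover have "prob {\<omega> \<in> space M. \<not> Z \<omega> \<le> b} = 1/3"
      using b by (subst prob_neg) (auto simp: G)
    then obtain \<omega>' where "\<not> Z \<omega>' \<le> b" "?U \<omega>' = expectation ?U"
      using meets[of "\<lambda>\<omega>. \<not> Z \<omega> \<le> b"] by auto
    then have "expectation ?U \<ge> 2/3"
      using mono[of b "Z \<omega>'"] b by simp
    ultimately show False by simp
  qed
  \<comment> \<open>Despite its name, \<open>variance_positive\<close> gives only nonnegativity;
    strictness comes from the contradiction above.\<close>
  then show ?thesis
    using variance_positive[of ?U] unfolding G_def by linarith
qed

theorem proposition3p1: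
  fixes M :: "'a measure" and Z1 Z2 :: "'a \<Rightarrow> real" and c :: real
  assumes "prob_space M"
    and "abs_continuous_rv M Z1"
    and "abs_continuous_rv M Z2"
    and "c > 0"
  shows "((\<lambda>(t, s). (cmod (cf_diff M Z1 Z2 t s))\<^sup>2
             / (cmod (cf_diff M Z1 Z1 t s) * cmod (cf_diff M Z2 Z2 t s)))
          \<longlongrightarrow> (correlation M (\<lambda>\<omega>. rv_cdf M Z1 (Z1 \<omega>)) (\<lambda>\<omega>. rv_cdf M Z2 (Z2 \<omega>)))\<^sup>2)
         (ratio_filter c)"
proof -
  interpret prob_space M by fact
  define U where "U = (\<lambda>\<omega>. rv_cdf M Z1 (Z1 \<omega>))"
  define V where "V = (\<lambda>\<omega>. rv_cdf M Z2 (Z2 \<omega>))"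
  have Z: "random_variable borel Z1" "random_variable borel Z2"
    using assms by (auto simp: abs_continuous_rv_def)
  have VU: "variance U > 0" and VV: "variance V > 0"
    unfolding U_def V_def using assms by (auto intro!: variance_rv_cdf_pos)
  have cov: "covariance M W W = variance W" for W
    by (simp add: covariance_def power2_eq_square)
  let ?F = "at (0::real) \<times>\<^sub>F at (0::real)"
  let ?q = "\<lambda>X Y p. cf_diff M X Y (fst p) (snd p) / of_real (fst p * snd p)"
  have lim: "(?q Z1 Z2 \<longlongrightarrow> - of_real (covariance M U V)) ?F"
    "(?q Z1 Z1 \<longlongrightarrow> - of_real (variance U)) ?F"
    "(?q Z2 Z2 \<longlongrightarrow> - of_real (variance V)) ?F"
    using cf_diff_quotient_tendsto[OF Z] cf_diff_quotient_tendsto[OF Z(1) Z(1)]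
      cf_diff_quotient_tendsto[OF Z(2) Z(2)]
    unfolding U_def[symmetric] V_def[symmetric] cov case_prod_beta' by auto
  \<comment> \<open>Positive variances make the limit of the denominator nonzero, so the quotient
    rule applies.\<close>
  have "((\<lambda>p. (cmod (?q Z1 Z2 p))\<^sup>2 / (cmod (?q Z1 Z1 p) * cmod (?q Z2 Z2 p)))
      \<longlongrightarrow> (cmod (- of_real (covariance M U V)))\<^sup>2
        / (cmod (- of_real (variance U)) * cmod (- of_real (variance V)))) ?F"
    using VU VV by (intro tendsto_intros lim) auto
  also have "(cmod (- of_real (covariance M U V)))\<^sup>2
        / (cmod (- of_real (variance U)) * cmod (- of_real (variance V))) = (correlation M U V)\<^sup>2"
    using VU VV by (simp add: correlation_def power_divide power_mult_distrib)
  finally have "((\<lambda>(t, s). (cmod (cf_diff M Z1 Z2 t s))\<^sup>2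
             / (cmod (cf_diff M Z1 Z1 t s) * cmod (cf_diff M Z2 Z2 t s)))
          \<longlongrightarrow> (correlation M U V)\<^sup>2) ?F"
  \<comment> \<open>Off the axes, numerator and denominator both carry the factor
    \<open>1 / \<bar>t * s\<bar>\<^sup>2\<close>, which cancels.\<close>
  proof (rule Lim_transform_eventually)
    show "\<forall>\<^sub>F p in ?F. (cmod (?q Z1 Z2 p))\<^sup>2 / (cmod (?q Z1 Z1 p) * cmod (?q Z2 Z2 p)) =
        (case p of (t, s) \<Rightarrow> (cmod (cf_diff M Z1 Z2 t s))\<^sup>2
             / (cmod (cf_diff M Z1 Z1 t s) * cmod (cf_diff M Z2 Z2 t s)))"
      using eventually_prod_at_0_neq
      by eventually_elim
        (auto simp: case_prod_beta' norm_divide norm_mult power_divide power2_eq_square)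
  qed
  \<comment> \<open>\<open>ratio_filter c\<close> is finer than the product filter, so it inherits
    the limit.\<close>
  then show ?thesis
    unfolding U_def V_def ratio_filter_def by (rule tendsto_mono[OF inf_le1])
qed

end
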